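(* Let $k$ be an algebraically closed field of characteristic zero. For $i=1,2$ let $\mathfrak g_i$ be a finite dimensional simple Lie superalgebra over $k$ and let $\sigma_i$ be an automorphism of $\mathfrak g_i$ of finite order. If $L(\mathfrak g_1,\sigma_1)\simeq L(\mathfrak g_2,\sigma_2)$ as $k$-Lie superalgebras, then $\mathfrak g_1\simeq\mathfrak g_2$ as $k$-Lie superalgebras.
   Context: Automorphisms of a Lie superalgebra $\mathfrak g=\mathfrak g_{\bar0}\oplus\mathfrak g_{\bar1}$ are $k$-linear bracket preserving bijections that stabilize $\mathfrak g_{\bar0}$ and $\mathfrak g_{\bar1}$; isomorphisms also preserve the $\mathbb Z_2$-grading. Fix a compatible family $(\zeta_m)_{m\ge1}$ of primitive $m$-th roots of unity in $k$ (so $\zeta_{lm}^l=\zeta_m$). Let $\sigma$ be an automorphism of $\mathfrak g$ with $\sigma^m=1$. Put $\mathfrak g_{i}^{\sigma}=\{x\in\mathfrak g:\sigma(x)=\zeta_m^ix\}$ for $i\in\mathbb Z$ (depending only on $i$ mod $m$). The loop algebra is the $k$-Lie superalgebra $$L(\mathfrak g,\sigma)=\bigoplus_{i\in\mathbb Z}\mathfrak g_i^{\sigma}\otimes z^i\subset\mathfrak g\otimes_kk[z^{\pm1}],$$ with bracket $[x\otimes z^i,y\otimes z^j]=[x,y]\otimes z^{i+j}$ and $\mathbb Z_2$-grading inherited from $\mathfrak g$. Up to isomorphism it does not depend on the choice of the period $m$. *)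

theory Defs
  imports
    "HOL-Computational_Algebra.Computational_Algebra"
    "HOL-Library.Poly_Mapping"
    "HOL-Library.Z2"
begin

text \<open>
  A \<open>k\<close>-superspace with a bracket is realised as a subspace \<open>sa_carrier\<close> of an ambient vector
  space given by the type \<open>'a\<close> with scalar multiplication \<open>sa_scale\<close>; the two-element field
  \<^typ>\<open>bit\<close> indexes the \<open>\<int>/2\<close>-grading. The bracket is a total function on \<open>'a\<close>, but only its
  values on the carrier matter.
\<close>

record ('k, 'a) superalgebra =
  sa_carrier :: "'a set"
  sa_scale :: "'k \<Rightarrow> 'a \<Rightarrow> 'a"
  sa_bracket :: "'a \<Rightarrow> 'a \<Rightarrow> 'a"
  sa_grade :: "bit \<Rightarrow> 'a set"

definition koszul_sign :: "bit \<Rightarrow> bit \<Rightarrow> 'k::ring_1" where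
  "koszul_sign a b = (if a * b = 1 then - 1 else 1)"

locale lie_superalgebra =
  vector_space "sa_scale G" for G :: "('k::field, 'a::ab_group_add) superalgebra" +
  assumes subspace_carrier: "subspace (sa_carrier G)"
    and subspace_grade: "subspace (sa_grade G a)"
    and carrier_eq_sum: "sa_carrier G = {x + y | x y. x \<in> sa_grade G 0 \<and> y \<in> sa_grade G 1}"
    and grade_direct: "sa_grade G 0 \<inter> sa_grade G 1 = {0}"
    and bracket_add_left:
      "\<lbrakk>x \<in> sa_carrier G; y \<in> sa_carrier G; z \<in> sa_carrier G\<rbrakk> \<Longrightarrow>
        sa_bracket G (x + y) z = sa_bracket G x z + sa_bracket G y z"
    and bracket_add_right:
      "\<lbrakk>x \<in> sa_carrier G; y \<in> sa_carrier G; z \<in> sa_carrier G\<rbrakk> \<Longrightarrow>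
        sa_bracket G x (y + z) = sa_bracket G x y + sa_bracket G x z"
    and bracket_scale_left:
      "\<lbrakk>x \<in> sa_carrier G; y \<in> sa_carrier G\<rbrakk> \<Longrightarrow>
        sa_bracket G (sa_scale G c x) y = sa_scale G c (sa_bracket G x y)"
    and bracket_scale_right:
      "\<lbrakk>x \<in> sa_carrier G; y \<in> sa_carrier G\<rbrakk> \<Longrightarrow>
        sa_bracket G x (sa_scale G c y) = sa_scale G c (sa_bracket G x y)"
    and bracket_grade:
      "\<lbrakk>x \<in> sa_grade G a; y \<in> sa_grade G b\<rbrakk> \<Longrightarrow> sa_bracket G x y \<in> sa_grade G (a + b)"
    and super_skew_symmetry:
      "\<lbrakk>x \<in> sa_grade G a; y \<in> sa_grade G b\<rbrakk> \<Longrightarrow>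
        sa_bracket G x y = - sa_scale G (koszul_sign a b) (sa_bracket G y x)"
    and super_jacobi:
      "\<lbrakk>x \<in> sa_grade G a; y \<in> sa_grade G b; z \<in> sa_grade G d\<rbrakk> \<Longrightarrow>
        sa_bracket G x (sa_bracket G y z) =
          sa_bracket G (sa_bracket G x y) z +
          sa_scale G (koszul_sign a b) (sa_bracket G y (sa_bracket G x z))"
begin

definition finite_dimensional :: bool where
  "finite_dimensional \<longleftrightarrow> (\<exists>B. finite B \<and> span B = sa_carrier G)"

text \<open>
  Ideals of a superalgebra are graded. One-sided absorption suffices by super skew-symmetry.
\<close>

definition graded_ideal :: "'a set \<Rightarrow> bool" where
  "graded_ideal I \<longleftrightarrow>
    subspace I \<and> I \<subseteq> sa_carrier G \<and>
    I = {x + y | x y. x \<in> I \<inter> sa_grade G 0 \<and> y \<in> I \<inter> sa_grade G 1} \<and>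
    (\<forall>x\<in>sa_carrier G. \<forall>y\<in>I. sa_bracket G x y \<in> I)"

end

locale simple_lie_superalgebra = lie_superalgebra +
  assumes nonabelian: "\<exists>x\<in>sa_carrier G. \<exists>y\<in>sa_carrier G. sa_bracket G x y \<noteq> 0"
    and ideal_trivial: "graded_ideal I \<Longrightarrow> I = {0} \<or> I = sa_carrier G"

definition superalgebra_iso ::
  "('k, 'a::ab_group_add) superalgebra \<Rightarrow> ('k, 'b::ab_group_add) superalgebra \<Rightarrow> ('a \<Rightarrow> 'b) \<Rightarrow> bool"
where
  "superalgebra_iso G H f \<longleftrightarrow>
    bij_betw f (sa_carrier G) (sa_carrier H) \<and>
    (\<forall>x\<in>sa_carrier G. \<forall>y\<in>sa_carrier G. f (x + y) = f x + f y) \<and>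
    (\<forall>c. \<forall>x\<in>sa_carrier G. f (sa_scale G c x) = sa_scale H c (f x)) \<and>
    (\<forall>x\<in>sa_carrier G. \<forall>y\<in>sa_carrier G. f (sa_bracket G x y) = sa_bracket H (f x) (f y)) \<and>
    (\<forall>a. f ` sa_grade G a = sa_grade H a)"

definition superalgebra_isomorphic ::
  "('k, 'a::ab_group_add) superalgebra \<Rightarrow> ('k, 'b::ab_group_add) superalgebra \<Rightarrow> bool"
  (infix \<open>\<simeq>\<^sub>s\<close> 50)
where
  "G \<simeq>\<^sub>s H \<longleftrightarrow> (\<exists>f. superalgebra_iso G H f)"

definition superalgebra_aut :: "('k, 'a::ab_group_add) superalgebra \<Rightarrow> ('a \<Rightarrow> 'a) \<Rightarrow> bool" where
  "superalgebra_aut G \<sigma> \<longleftrightarrow> superalgebra_iso G G \<sigma>"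

text \<open>\<open>m\<close> need not be the exact order of \<open>\<sigma>\<close>.\<close>

definition has_period :: "('k, 'a) superalgebra \<Rightarrow> ('a \<Rightarrow> 'a) \<Rightarrow> nat \<Rightarrow> bool" where
  "has_period G \<sigma> m \<longleftrightarrow> m \<ge> 1 \<and> (\<forall>x\<in>sa_carrier G. (\<sigma> ^^ m) x = x)"

definition primitive_root_of_unity :: "nat \<Rightarrow> 'k::field \<Rightarrow> bool" where
  "primitive_root_of_unity m w \<longleftrightarrow> m \<ge> 1 \<and> w ^ m = 1 \<and> (\<forall>d. 1 \<le> d \<and> d < m \<longrightarrow> w ^ d \<noteq> 1)"

definition compatible_roots :: "(nat \<Rightarrow> 'k::field) \<Rightarrow> bool" where
  "compatible_roots \<zeta> \<longleftrightarrow>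
    (\<forall>m\<ge>1. primitive_root_of_unity m (\<zeta> m)) \<and>
    (\<forall>l\<ge>1. \<forall>m\<ge>1. \<zeta> (l * m) ^ l = \<zeta> m)"

text \<open>The \<open>w ^ i\<close>-eigenspace of \<open>\<sigma>\<close>; below, \<open>w\<close> is the chosen primitive \<open>m\<close>-th root of unity.\<close>

definition eigen_component ::
  "('k::field, 'a) superalgebra \<Rightarrow> ('a \<Rightarrow> 'a) \<Rightarrow> 'k \<Rightarrow> int \<Rightarrow> 'a set"
where
  "eigen_component G \<sigma> w i = {x \<in> sa_carrier G. \<sigma> x = sa_scale G (w powi i) x}"

text \<open>
  Finitely supported functions \<^typ>\<open>int \<Rightarrow>\<^sub>0 'a\<close> encode \<open>'a \<otimes> k[z\<^sup>\<plusminus>\<^sup>1]\<close>: the function \<open>f\<close>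
  stands for the sum of the \<open>f i \<otimes> z ^ i\<close>.
\<close>

definition loop_algebra ::
  "('k::field, 'a::ab_group_add) superalgebra \<Rightarrow> ('a \<Rightarrow> 'a) \<Rightarrow> 'k \<Rightarrow>
    ('k, int \<Rightarrow>\<^sub>0 'a) superalgebra"
where
  "loop_algebra G \<sigma> w =
    \<lparr> sa_carrier = {f. \<forall>i. Poly_Mapping.lookup f i \<in> eigen_component G \<sigma> w i},
      sa_scale = (\<lambda>c. Poly_Mapping.map (sa_scale G c)),
      sa_bracket = (\<lambda>f g. \<Sum>i\<in>Poly_Mapping.keys f. \<Sum>j\<in>Poly_Mapping.keys g.
        Poly_Mapping.single (i + j) (sa_bracket G (Poly_Mapping.lookup f i) (Poly_Mapping.lookup g j))),
      sa_grade = (\<lambda>a. {f. \<forall>i. Poly_Mapping.lookup f i \<in> eigen_component G \<sigma> w i \<inter> sa_grade G a}) \<rparr>"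

end

theory Submission
  imports Defs
begin

text \<open>
  Composing the given isomorphism with evaluation at \<open>z = 1\<close> yields a graded epimorphism \<open>\<psi>\<close> from
  \<open>L(G1, \<sigma>1)\<close> onto the simple algebra \<open>G2\<close>. Multiplication by \<open>z ^ m1\<close> commutes with all brackets,
  so it preserves the kernel of \<open>\<psi>\<close> (as \<open>G2\<close> has trivial centre) and descends to \<open>G2\<close>, where it is
  a scalar \<open>c \<noteq> 0\<close> by Schur's lemma. If \<open>a ^ m1 = c\<close>, then \<open>\<psi>\<close> factors through the evaluation
  \<open>L(G1, \<sigma>1) \<rightarrow> G1\<close> at \<open>z = a\<close>, and the induced epimorphism \<open>G1 \<rightarrow> G2\<close> is injective because
  \<open>G1\<close> is simple.
\<close>

section \<open>Linear algebra: eigenvectors of operators on finite-dimensional subspaces\<close>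

text \<open>Brackets, automorphisms and homomorphisms are controlled only on carriers, so additivity
  is asked only on a set \<open>A\<close> that contains all partial sums. Cancellation in the target
  gives \<open>f 0 = 0\<close>, which settles empty and infinite index sets.\<close>

lemma sum_additive_on:
  fixes f :: "'a::comm_monoid_add \<Rightarrow> 'b::ab_group_add"
  assumes add: "\<And>x y. \<lbrakk>x \<in> A; y \<in> A\<rbrakk> \<Longrightarrow> f (x + y) = f x + f y"
    and closed: "0 \<in> A" "\<And>x y. \<lbrakk>x \<in> A; y \<in> A\<rbrakk> \<Longrightarrow> x + y \<in> A"
    and g: "\<And>i. i \<in> I \<Longrightarrow> g i \<in> A"
  shows "f (sum g I) = (\<Sum>i\<in>I. f (g i))"
proof -
  have "f (0 + 0) = f 0 + f 0" using closed by (intro add)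
  then have f0: "f 0 = 0" by simp
  have "sum g I \<in> A \<and> f (sum g I) = (\<Sum>i\<in>I. f (g i))"
    using g by (induction I rule: infinite_finite_induct) (auto simp: f0 add closed)
  then show ?thesis ..
qed

text \<open>The relation is recorded as a polynomial so that, for the iterates of an operator, it
  can be factored. A repeated value gives X^i - X^j; an injective sequence has infinite range in a
  finitely generated span, hence a dependent one.\<close>

lemma (in vector_space) sequence_dependent:
  assumes "finite B" and v: "\<And>n. v n \<in> span B"
  shows "\<exists>p \<noteq> 0. (\<Sum>j\<le>degree p. coeff p j *s v j) = 0"
proof -
  have sum_coeff: "(\<Sum>j\<le>degree p. coeff p j *s v j) = (\<Sum>j\<in>J. coeff p j *s v j)"
    if "finite J" "\<And>j. j \<notin> J \<Longrightarrow> coeff p j = 0" for p :: "'a poly" and J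
  proof (rule sum.mono_neutral_cong)
    show "coeff p i *s v i = 0" if "i \<in> {..degree p} - J" for i
      using that \<open>\<And>j. j \<notin> J \<Longrightarrow> coeff p j = 0\<close> by simp
    show "coeff p i *s v i = 0" if "i \<in> J - {..degree p}" for i
      using that by (simp add: coeff_eq_0)
  qed (use that in auto)
  show ?thesis
  proof (cases "inj v")
    case False
    then obtain i j where ij: "v i = v j" "i \<noteq> j" by (auto simp: inj_def)
    let ?p = "monom 1 i - monom 1 j :: 'a poly"
    have "coeff ?p i = 1" using ij by simp
    then have "?p \<noteq> 0" by (metis coeff_0 zero_neq_one)
    moreover have "(\<Sum>k\<le>degree ?p. coeff ?p k *s v k) = (\<Sum>k\<in>{i,j}. coeff ?p k *s v k)"
      by (rule sum_coeff) auto
    then have "(\<Sum>k\<le>degree ?p. coeff ?p k *s v k) = 0" using ij by simp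
    ultimately show ?thesis by blast
  next
    case True
    have "dependent (range v)"
    proof (rule ccontr)
      assume "independent (range v)"
      then have "finite (range v)"
        using independent_span_bound[OF \<open>finite B\<close>] v by blast
      then show False using True finite_imageD by blast
    qed
    then obtain t u y where t: "finite t" "t \<subseteq> range v" "(\<Sum>x\<in>t. u x *s x) = 0"
      and y: "y \<in> t" "u y \<noteq> 0"
      unfolding dependent_explicit by blast
    \<comment> \<open>Injectivity of \<open>v\<close> turns the relation among the vectors in
      \<open>t\<close> into one among their indices, which supplies the coefficients of
      \<open>p\<close>.\<close>
    define J where "J = v -` t"
    have J: "finite J" "t = v ` J"
      unfolding J_def using t True by (auto intro: finite_vimageI)
    define p where "p = (\<Sum>j\<in>J. monom (u (v j)) j)"
    have cp: "coeff p k = (if k \<in> J then u (v k) else 0)" for k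
      unfolding p_def by (simp add: coeff_sum J)
    obtain k where "k \<in> J" "y = v k" using J y by auto
    then have "coeff p k \<noteq> 0" using y cp by simp
    then have "p \<noteq> 0" by auto
    moreover have "(\<Sum>j\<le>degree p. coeff p j *s v j) = (\<Sum>j\<in>J. coeff p j *s v j)"
      by (rule sum_coeff) (use J cp in auto)
    moreover have "\<dots> = (\<Sum>x\<in>t. u x *s x)"
      unfolding J(2) by (subst sum.reindex) (use True cp in \<open>auto intro: inj_on_subset\<close>)
    ultimately show ?thesis using t by auto
  qed
qed

text \<open>Take a nonzero polynomial p of least degree with p(T)x = 0. It is not constant because
  \<open>x\<close> is nonzero, so p = (X - c)q for a root c. By minimality q(T)x is nonzero, and T -
  c kills it.\<close>

lemma eigenvector_exists:
  fixes scale :: "'k::alg_closed_field \<Rightarrow> 'a::ab_group_add \<Rightarrow> 'a"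
  assumes vs: "vector_space scale"
    and fin: "finite B" and W: "W = module.span scale B"
    and T_closed: "\<And>x. x \<in> W \<Longrightarrow> T x \<in> W"
    and T_add: "\<And>x y. \<lbrakk>x \<in> W; y \<in> W\<rbrakk> \<Longrightarrow> T (x + y) = T x + T y"
    and T_scale: "\<And>c x. x \<in> W \<Longrightarrow> T (scale c x) = scale c (T x)"
    and x: "x \<in> W" "x \<noteq> 0"
  shows "\<exists>c. \<exists>y\<in>W. y \<noteq> 0 \<and> T y = scale c y"
proof -
  interpret vector_space scale by (rule vs)
  have sub: "subspace W" unfolding W by simp
  define v where "v n = (T ^^ n) x" for n
  have v: "v n \<in> W" for n unfolding v_def by (induction n) (use x T_closed in auto)
  \<comment> \<open>\<open>ev p\<close> is p(T)x, written as a combination of iterates because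
    \<open>T\<close> is linear on \<open>W\<close> only.\<close>
  define ev where "ev p = (\<Sum>j\<le>degree p. scale (coeff p j) (v j))" for p :: "'k poly"
  have ev_eq: "ev p = (\<Sum>j\<le>n. scale (coeff p j) (v j))" if "degree p \<le> n" for p n
    unfolding ev_def by (rule sum.mono_neutral_left) (use that in \<open>auto simp: coeff_eq_0\<close>)
  have ev_closed: "ev p \<in> W" for p
    unfolding ev_def by (intro subspace_sum subspace_scale sub v)
  have T_ev: "T (ev p) = (\<Sum>j\<le>degree p. scale (coeff p j) (v (Suc j)))" for p
  proof -
    have "T (ev p) = (\<Sum>j\<le>degree p. T (scale (coeff p j) (v j)))"
      unfolding ev_def
      by (rule sum_additive_on[where A = W])
        (auto intro: T_add subspace_0 subspace_add subspace_scale sub v)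
    then show ?thesis by (simp add: T_scale v) (simp add: v_def)
  qed
  define n where "n = (LEAST n. \<exists>p. p \<noteq> 0 \<and> ev p = 0 \<and> degree p = n)"
  have "\<exists>n p. p \<noteq> 0 \<and> ev p = 0 \<and> degree p = n"
    using sequence_dependent[OF fin, of v] v unfolding W ev_def by auto
  then have "\<exists>p. p \<noteq> 0 \<and> ev p = 0 \<and> degree p = n"
    unfolding n_def by (rule LeastI_ex)
  then obtain p where p: "p \<noteq> 0" "ev p = 0" "degree p = n" by blast
  have minimal: "ev q \<noteq> 0" if "q \<noteq> 0" "degree q < n" for q
    using that not_less_Least unfolding n_def by blast
  have "n \<noteq> 0"
  proof
    assume "n = 0"
    then have "ev p = scale (coeff p 0) x" using p unfolding ev_def v_def by simp
    moreover have "coeff p 0 \<noteq> 0" using p \<open>n = 0\<close> leading_coeff_0_iff[of p] by simp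
    ultimately show False using p x by simp
  qed
  then obtain c where "poly p c = 0" using alg_closed_imp_poly_has_root[of p] p by auto
  then obtain q where q: "p = [:- c, 1:] * q" by (auto simp: poly_eq_0_iff_dvd)
  have "q \<noteq> 0" using p q by auto
  then have deg: "degree p = Suc (degree q)" unfolding q by (subst degree_mult_eq) auto
  have cp: "coeff p j = coeff (pCons 0 q) j - c * coeff q j" for j unfolding q by simp
  \<comment> \<open>This evaluates p = Xq - cq. The coefficients \<open>pCons 0 q\<close> of Xq pair
    with iterates moved on by one, which gives \<open>T (ev q)\<close>.\<close>
  have "ev p = (\<Sum>j\<le>Suc (degree q). scale (coeff (pCons 0 q) j) (v j)) -
      scale c (\<Sum>j\<le>Suc (degree q). scale (coeff q j) (v j))"
    unfolding ev_def deg cp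
    by (simp only: scale_left_diff_distrib sum_subtractf scale_sum_right scale_scale)
  also have "(\<Sum>j\<le>Suc (degree q). scale (coeff q j) (v j)) = ev q"
    by (rule ev_eq[symmetric]) simp
  also have "(\<Sum>j\<le>Suc (degree q). scale (coeff (pCons 0 q) j) (v j)) = T (ev q)"
    unfolding T_ev by (subst sum.atMost_Suc_shift) simp
  finally have "T (ev q) = scale c (ev q)" using p by simp
  moreover have "ev q \<noteq> 0" using minimal \<open>q \<noteq> 0\<close> deg p by simp
  ultimately show ?thesis using ev_closed by blast
qed

section \<open>Homogeneous components and graded ideals of a Lie superalgebra\<close>

context lie_superalgebra
begin

lemma grade_unique:
  assumes "x \<in> sa_grade G 0" "x' \<in> sa_grade G 0" "y \<in> sa_grade G 1" "y' \<in> sa_grade G 1"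
    and "x + y = x' + y'"
  shows "x = x'" "y = y'"
proof -
  have eq: "x - x' = y' - y" using assms(5) by (simp add: algebra_simps)
  have "x - x' \<in> sa_grade G 0" by (intro subspace_diff subspace_grade assms)
  moreover have "x - x' \<in> sa_grade G 1"
    unfolding eq by (intro subspace_diff subspace_grade assms)
  ultimately have "x - x' = 0" using grade_direct by blast
  then show "x = x'" "y = y'" using eq by auto
qed

lemma grade_subset_carrier: "sa_grade G a \<subseteq> sa_carrier G"
proof
  fix x assume x: "x \<in> sa_grade G a"
  have "0 \<in> sa_grade G b" for b using subspace_0 subspace_grade by blast
  then show "x \<in> sa_carrier G"
    unfolding carrier_eq_sum using x
    by (cases a) (metis (mono_tags, lifting) add.left_neutral add.right_neutral mem_Collect_eq)+
qed

lemma carrierE: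
  assumes "x \<in> sa_carrier G"
  obtains x0 x1 where "x = x0 + x1" "x0 \<in> sa_grade G 0" "x1 \<in> sa_grade G 1"
  using assms unfolding carrier_eq_sum by blast

lemmas carrier_add = subspace_add[OF subspace_carrier]
lemmas carrier_scale = subspace_scale[OF subspace_carrier]
lemmas carrier_zero = subspace_0[OF subspace_carrier]
lemmas carrier_diff = subspace_diff[OF subspace_carrier]
lemmas carrier_sum = subspace_sum[OF subspace_carrier]
lemmas grade_carrier = subsetD[OF grade_subset_carrier]

lemma bracket_carrier:
  assumes "x \<in> sa_carrier G" "y \<in> sa_carrier G"
  shows "sa_bracket G x y \<in> sa_carrier G"
proof -
  obtain x0 x1 where x: "x = x0 + x1" "x0 \<in> sa_grade G 0" "x1 \<in> sa_grade G 1"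
    using assms carrierE by blast
  obtain y0 y1 where y: "y = y0 + y1" "y0 \<in> sa_grade G 0" "y1 \<in> sa_grade G 1"
    using assms carrierE by blast
  note in_carrier = x(2,3)[THEN grade_carrier] y(2,3)[THEN grade_carrier]
  have "sa_bracket G u v \<in> sa_carrier G" if "u \<in> {x0, x1}" "v \<in> {y0, y1}" for u v
    using that x y by (auto intro: grade_carrier bracket_grade)
  then show ?thesis
    by (simp add: x(1) y(1) bracket_add_left bracket_add_right carrier_add in_carrier)
qed

lemma bracket_zero_left [simp]: "y \<in> sa_carrier G \<Longrightarrow> sa_bracket G 0 y = 0"
  using bracket_scale_left[of 0 y 0] carrier_zero by simp

lemma bracket_zero_right [simp]: "x \<in> sa_carrier G \<Longrightarrow> sa_bracket G x 0 = 0"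
  using bracket_scale_right[of x 0 0] carrier_zero by simp

text \<open>In a subspace only the even component needs checking: the odd one is the difference of
  the element and its even component.\<close>

lemma graded_idealI:
  assumes "subspace I" "I \<subseteq> sa_carrier G"
    and hom: "\<And>x y. \<lbrakk>x \<in> sa_grade G 0; y \<in> sa_grade G 1; x + y \<in> I\<rbrakk> \<Longrightarrow> x \<in> I"
    and "\<And>x y. \<lbrakk>x \<in> sa_carrier G; y \<in> I\<rbrakk> \<Longrightarrow> sa_bracket G x y \<in> I"
  shows "graded_ideal I"
proof -
  have "z \<in> {x + y | x y. x \<in> I \<inter> sa_grade G 0 \<and> y \<in> I \<inter> sa_grade G 1}" if z: "z \<in> I" for z
  proof -
    obtain x y where xy: "z = x + y" "x \<in> sa_grade G 0" "y \<in> sa_grade G 1"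
      using z assms(2) carrierE by blast
    then have "x \<in> I" using hom z by blast
    then have "z - x \<in> I" using z assms(1) subspace_diff by blast
    then show ?thesis using xy \<open>x \<in> I\<close> by auto
  qed
  moreover have "{x + y | x y. x \<in> I \<inter> sa_grade G 0 \<and> y \<in> I \<inter> sa_grade G 1} \<subseteq> I"
    using assms(1) subspace_add by blast
  ultimately have "I = {x + y | x y. x \<in> I \<inter> sa_grade G 0 \<and> y \<in> I \<inter> sa_grade G 1}" by blast
  then show ?thesis unfolding graded_ideal_def using assms by blast
qed

text \<open>For homogeneous x the brackets with the even and the odd component of y have different
  parity, so both vanish when their sum does. A general x is then split into its components.\<close>

lemma graded_ideal_annihilator:
  "graded_ideal {y \<in> sa_carrier G. \<forall>x\<in>sa_carrier G. sa_bracket G x y = 0}" (is "graded_ideal ?Z")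
proof (rule graded_idealI)
  show "subspace ?Z"
    unfolding subspace_def
    by (auto simp: carrier_zero carrier_add carrier_scale bracket_add_right bracket_scale_right)
  fix y0 y1 assume y: "y0 \<in> sa_grade G 0" "y1 \<in> sa_grade G 1" "y0 + y1 \<in> ?Z"
  have "sa_bracket G x y0 = 0" if x: "x \<in> sa_grade G a" for x a
  proof -
    have br: "sa_bracket G x y0 \<in> sa_grade G a" "sa_bracket G x y1 \<in> sa_grade G (a + 1)"
      using bracket_grade[OF x y(1)] bracket_grade[OF x y(2)] by (simp_all only: add.right_neutral)
    have sum0: "sa_bracket G x y0 + sa_bracket G x y1 = 0"
      using y(3) bracket_add_right[of x y0 y1] grade_carrier x y(1,2) by auto
    have zero: "0 \<in> sa_grade G b" for b using subspace_0 subspace_grade by blast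
    show ?thesis
    \<comment> \<open>\<open>grade_unique\<close> takes the even summand first, so the two brackets
      exchange places when \<open>x\<close> is odd.\<close>
    proof (cases "a = 0")
      case True
      then show ?thesis
        using grade_unique(1)[of "sa_bracket G x y0" 0 "sa_bracket G x y1" 0] br sum0 zero by simp
    next
      case False
      then have "a = 1" by simp
      then show ?thesis
        using grade_unique(2)[of "sa_bracket G x y1" 0 "sa_bracket G x y0" 0] br sum0 zero
        by (simp add: add.commute)
    qed
  qed
  note ann = this
  have "sa_bracket G x y0 = 0" if "x \<in> sa_carrier G" for x
  proof -
    obtain x0 x1 where "x = x0 + x1" "x0 \<in> sa_grade G 0" "x1 \<in> sa_grade G 1"
      using \<open>x \<in> sa_carrier G\<close> carrierE by blast
    then show ?thesis using bracket_add_left[of x0 x1 y0] ann y(1) grade_carrier by auto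
  qed
  then show "y0 \<in> ?Z" using y(1) grade_carrier by blast
qed (auto simp: bracket_carrier carrier_zero)

text \<open>\<open>T\<close> is an even element of the centroid. Preserving parity lets the
  eigenvalue equation be compared component by component; commuting with left multiplications gives
  absorption.\<close>

lemma graded_ideal_eigenspace:
  assumes closed: "\<And>x a. x \<in> sa_grade G a \<Longrightarrow> T x \<in> sa_grade G a"
    and add: "\<And>x y. \<lbrakk>x \<in> sa_carrier G; y \<in> sa_carrier G\<rbrakk> \<Longrightarrow> T (x + y) = T x + T y"
    and scale: "\<And>c x. x \<in> sa_carrier G \<Longrightarrow> T (sa_scale G c x) = sa_scale G c (T x)"
    and bracket: "\<And>x y. \<lbrakk>x \<in> sa_carrier G; y \<in> sa_carrier G\<rbrakk> \<Longrightarrow>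
      T (sa_bracket G x y) = sa_bracket G x (T y)"
  shows "graded_ideal {y \<in> sa_carrier G. T y = sa_scale G c y}" (is "graded_ideal ?N")
proof (rule graded_idealI)
  have "T 0 = 0" using scale[of 0 0] carrier_zero by simp
  then show "subspace ?N"
    unfolding subspace_def
    by (auto simp: carrier_zero carrier_add carrier_scale add scale scale_right_distrib mult.commute)
  fix x y assume xy: "x \<in> sa_grade G 0" "y \<in> sa_grade G 1" "x + y \<in> ?N"
  then have "T x + T y = sa_scale G c x + sa_scale G c y"
    by (simp add: add grade_carrier scale_right_distrib)
  then have "T x = sa_scale G c x"
    using xy grade_unique(1) closed subspace_scale[OF subspace_grade] by blast
  then show "x \<in> ?N" using xy grade_carrier by blast
qed (auto simp: bracket bracket_scale_right bracket_carrier)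

end

section \<open>Trivial centre and Schur's lemma for simple superalgebras\<close>

lemma (in simple_lie_superalgebra) annihilator_trivial:
  assumes "y \<in> sa_carrier G" "\<And>x. x \<in> sa_carrier G \<Longrightarrow> sa_bracket G x y = 0"
  shows "y = 0"
proof -
  let ?Z = "{y \<in> sa_carrier G. \<forall>x\<in>sa_carrier G. sa_bracket G x y = 0}"
  have "?Z \<noteq> sa_carrier G" using nonabelian by blast
  then have "?Z = {0}" using ideal_trivial[OF graded_ideal_annihilator] by blast
  then show ?thesis using assms by blast
qed

text \<open>Finite dimension and algebraic closedness provide an eigenvector of \<open>T\<close>.
  Its eigenspace is a nonzero graded ideal, hence the whole algebra.\<close>

lemma schur:
  fixes G :: "('k::alg_closed_field, 'a::ab_group_add) superalgebra"
  assumes simple: "simple_lie_superalgebra G" and fin: "lie_superalgebra.finite_dimensional G"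
    and T_grade: "\<And>x a. x \<in> sa_grade G a \<Longrightarrow> T x \<in> sa_grade G a"
    and T_add: "\<And>x y. \<lbrakk>x \<in> sa_carrier G; y \<in> sa_carrier G\<rbrakk> \<Longrightarrow> T (x + y) = T x + T y"
    and T_scale: "\<And>c x. x \<in> sa_carrier G \<Longrightarrow> T (sa_scale G c x) = sa_scale G c (T x)"
    and T_bracket: "\<And>x y. \<lbrakk>x \<in> sa_carrier G; y \<in> sa_carrier G\<rbrakk> \<Longrightarrow>
      T (sa_bracket G x y) = sa_bracket G x (T y)"
  shows "\<exists>c. \<forall>x\<in>sa_carrier G. T x = sa_scale G c x"
proof -
  interpret simple_lie_superalgebra G by (rule simple)
  obtain B where B: "finite B" "sa_carrier G = span B"
    using fin unfolding finite_dimensional_def by blast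
  obtain x where x: "x \<in> sa_carrier G" "x \<noteq> 0" using nonabelian bracket_zero_left by blast
  have T_closed: "T y \<in> sa_carrier G" if y: "y \<in> sa_carrier G" for y
    using y
    by (elim carrierE)
      (auto simp: T_add grade_carrier intro!: carrier_add intro: T_grade grade_carrier)
  obtain c y where y: "y \<in> sa_carrier G" "y \<noteq> 0" "T y = sa_scale G c y"
    using eigenvector_exists[OF vector_space_axioms B T_closed T_add T_scale x] by blast
  have "graded_ideal {y \<in> sa_carrier G. T y = sa_scale G c y}"
    by (rule graded_ideal_eigenspace) (fact T_grade T_add T_scale T_bracket)+
  then have "{y \<in> sa_carrier G. T y = sa_scale G c y} = sa_carrier G"
    using ideal_trivial y by blast
  then show ?thesis by blast
qed

section \<open>Brackets of finite sums, and eigenspaces of an automorphism of finite order\<close>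

context lie_superalgebra
begin

lemma bracket_sum_left:
  assumes "\<And>i. i \<in> I \<Longrightarrow> x i \<in> sa_carrier G" "y \<in> sa_carrier G"
  shows "sa_bracket G (sum x I) y = (\<Sum>i\<in>I. sa_bracket G (x i) y)"
  by (rule sum_additive_on[where A = "sa_carrier G" and f = "\<lambda>x. sa_bracket G x y"])
    (auto simp: assms bracket_add_left carrier_zero carrier_add)

lemma bracket_sum_right:
  assumes "\<And>i. i \<in> I \<Longrightarrow> y i \<in> sa_carrier G" "x \<in> sa_carrier G"
  shows "sa_bracket G x (sum y I) = (\<Sum>i\<in>I. sa_bracket G x (y i))"
  by (rule sum_additive_on[where A = "sa_carrier G" and f = "\<lambda>y. sa_bracket G x y"])
    (auto simp: assms bracket_add_right carrier_zero carrier_add)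

end

locale twisted_loop = lie_superalgebra G
  for G :: "('k::field_char_0, 'a::ab_group_add) superalgebra" +
  fixes \<sigma> :: "'a \<Rightarrow> 'a" and m :: nat and w :: 'k
  assumes aut: "superalgebra_aut G \<sigma>" and period: "has_period G \<sigma> m"
    and root: "primitive_root_of_unity m w"
begin

abbreviation scaleG (infixr \<open>*\<^sub>G\<close> 75) where "c *\<^sub>G x \<equiv> sa_scale G c x"
abbreviation eigen where "eigen \<equiv> eigen_component G \<sigma> w"
abbreviation loop where "loop \<equiv> loop_algebra G \<sigma> w"

lemma m_pos: "m > 0" and w_power: "w ^ m = 1" and w_nonzero: "w \<noteq> 0"
  using root unfolding primitive_root_of_unity_def by (auto simp: power_0_left split: if_splits)

lemma aut_carrier: "x \<in> sa_carrier G \<Longrightarrow> \<sigma> x \<in> sa_carrier G"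
  and aut_add: "\<lbrakk>x \<in> sa_carrier G; y \<in> sa_carrier G\<rbrakk> \<Longrightarrow> \<sigma> (x + y) = \<sigma> x + \<sigma> y"
  and aut_scale: "x \<in> sa_carrier G \<Longrightarrow> \<sigma> (c *\<^sub>G x) = c *\<^sub>G \<sigma> x"
  and aut_bracket: "\<lbrakk>x \<in> sa_carrier G; y \<in> sa_carrier G\<rbrakk> \<Longrightarrow>
    \<sigma> (sa_bracket G x y) = sa_bracket G (\<sigma> x) (\<sigma> y)"
  using aut unfolding superalgebra_aut_def superalgebra_iso_def by (auto dest: bij_betwE)

lemma aut_grade: "x \<in> sa_grade G a \<Longrightarrow> \<sigma> x \<in> sa_grade G a"
  using aut unfolding superalgebra_aut_def superalgebra_iso_def by blast

lemma aut_zero: "\<sigma> 0 = 0"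
  using aut_scale[of 0 0] carrier_zero by simp

lemma funpow_carrier: "x \<in> sa_carrier G \<Longrightarrow> (\<sigma> ^^ j) x \<in> sa_carrier G"
  by (induction j) (auto intro: aut_carrier)

lemma funpow_grade: "x \<in> sa_grade G a \<Longrightarrow> (\<sigma> ^^ j) x \<in> sa_grade G a"
  by (induction j) (auto intro: aut_grade)

lemma funpow_add:
  "\<lbrakk>x \<in> sa_carrier G; y \<in> sa_carrier G\<rbrakk> \<Longrightarrow> (\<sigma> ^^ j) (x + y) = (\<sigma> ^^ j) x + (\<sigma> ^^ j) y"
  by (induction j) (auto simp: aut_add funpow_carrier)

lemma funpow_scale: "x \<in> sa_carrier G \<Longrightarrow> (\<sigma> ^^ j) (c *\<^sub>G x) = c *\<^sub>G (\<sigma> ^^ j) x"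
  by (induction j) (auto simp: aut_scale funpow_carrier)

text \<open>Reduction mod \<open>m\<close> brings the exponent into the range from 0 to m - 1, where
  primitivity allows only 0.\<close>

lemma w_powi_eq_1_iff: "w powi i = 1 \<longleftrightarrow> int m dvd i"
proof -
  have "w powi i = w powi (int m * (i div int m) + i mod int m)" by simp
  also have "\<dots> = w powi (i mod int m)"
    by (subst power_int_add) (simp_all add: w_nonzero power_int_mult w_power)
  also have "\<dots> = w ^ nat (i mod int m)"
    using m_pos by (simp add: power_int_def)
  finally have eq: "w powi i = w ^ nat (i mod int m)" .
  have "nat (i mod int m) < m" using m_pos by (simp add: nat_less_iff)
  then have "w ^ nat (i mod int m) = 1 \<longleftrightarrow> nat (i mod int m) = 0"
    using root unfolding primitive_root_of_unity_def
    by (metis One_nat_def Suc_leI neq0_conv power_0)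
  then show ?thesis
    using m_pos unfolding eq by (auto simp: dvd_eq_mod_eq_0) (simp add: order_antisym)
qed

lemma w_powi_period: "w powi (i + int m * q) = w powi i"
  by (simp add: power_int_add power_int_mult w_nonzero w_power)

text \<open>Orthogonality of the characters of Z/m: a geometric sum whose ratio is an m-th root of
  unity.\<close>

lemma sum_w_powi: "(\<Sum>j<m. (w powi i) ^ j) = (if int m dvd i then of_nat m else 0)"
proof (cases "int m dvd i")
  case True
  then have "w powi i = 1" by (simp add: w_powi_eq_1_iff)
  then show ?thesis using True by simp
next
  case False
  have "(w powi i) ^ m = (w powi int m) powi i"
    by (simp flip: power_int_of_nat power_int_mult add: mult.commute)
  then have "(w powi i) ^ m = 1" by (simp add: w_power)
  then show ?thesis using False w_powi_eq_1_iff[of i] by (simp add: geometric_sum)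
qed

lemma eigenD: "x \<in> eigen i \<Longrightarrow> x \<in> sa_carrier G" "x \<in> eigen i \<Longrightarrow> \<sigma> x = (w powi i) *\<^sub>G x"
  by (auto simp: eigen_component_def)

lemma subspace_eigen: "subspace (eigen i)"
  unfolding subspace_def eigen_component_def
  by (auto simp: carrier_zero carrier_add carrier_scale aut_zero aut_add aut_scale
      scale_right_distrib mult.commute)

lemma eigen_period: "eigen (i + int m * q) = eigen i"
  by (simp add: eigen_component_def w_powi_period)

lemma bracket_eigen:
  assumes "x \<in> eigen i" "y \<in> eigen j"
  shows "sa_bracket G x y \<in> eigen (i + j)"
  using assms
  by (auto simp: eigen_component_def bracket_carrier aut_bracket bracket_scale_left
      bracket_scale_right carrier_scale power_int_add w_nonzero mult.commute)

lemma funpow_eigen: "x \<in> eigen i \<Longrightarrow> (\<sigma> ^^ j) x = (w powi i) ^ j *\<^sub>G x"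
  by (induction j) (auto simp: eigenD aut_scale)

text \<open>The projection onto \<open>eigen r\<close> as a discrete Fourier average over the powers
  of \<sigma>. Dividing by \<open>m\<close> is legitimate in characteristic zero.\<close>

definition eigen_proj :: "int \<Rightarrow> 'a \<Rightarrow> 'a" where
  "eigen_proj r x = (1 / of_nat m) *\<^sub>G (\<Sum>j<m. (w powi (- r)) ^ j *\<^sub>G (\<sigma> ^^ j) x)"

lemma eigen_proj_add:
  "\<lbrakk>x \<in> sa_carrier G; y \<in> sa_carrier G\<rbrakk> \<Longrightarrow>
    eigen_proj r (x + y) = eigen_proj r x + eigen_proj r y"
  unfolding eigen_proj_def by (simp add: funpow_add scale_right_distrib sum.distrib)

lemma eigen_proj_scale: "x \<in> sa_carrier G \<Longrightarrow> eigen_proj r (c *\<^sub>G x) = c *\<^sub>G eigen_proj r x"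
  unfolding eigen_proj_def by (simp add: funpow_scale scale_sum_right mult.commute mult.left_commute)

lemma eigen_proj_grade: "x \<in> sa_grade G a \<Longrightarrow> eigen_proj r x \<in> sa_grade G a"
  unfolding eigen_proj_def
  by (intro subspace_scale[OF subspace_grade] subspace_sum[OF subspace_grade] funpow_grade)

text \<open>Applying \<sigma> turns each term of the average into w^r times the next one. The period
  makes term \<open>m\<close> equal to term 0, so the moved sum is the original sum.\<close>

lemma eigen_proj_eigen:
  assumes x: "x \<in> sa_carrier G"
  shows "eigen_proj r x \<in> eigen r"
proof -
  define F where "F j = (w powi (- r)) ^ j *\<^sub>G (\<sigma> ^^ j) x" for j
  have F: "F j \<in> sa_carrier G" for j
    unfolding F_def using x by (intro carrier_scale funpow_carrier)
  have \<sigma>F: "\<sigma> (F j) = (w powi r) *\<^sub>G F (Suc j)" for j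
  proof -
    have "w powi r * w powi (- r) = 1" by (simp add: power_int_minus w_nonzero)
    then show ?thesis
      unfolding F_def using x by (simp add: aut_scale funpow_carrier)
  qed
  have "(\<Sum>j<m. F (Suc j)) = sum F {..<m}"
  proof -
    have "(w powi (- r)) ^ m = 1"
      using sum_w_powi w_power
      by (metis mult.commute power_int_1_left power_int_mult power_int_of_nat)
    then have "F m = F 0" unfolding F_def using period x by (simp add: has_period_def)
    moreover have "F 0 + (\<Sum>j<m. F (Suc j)) = sum F {..<m} + F m"
      using sum.lessThan_Suc_shift[of F m] by simp
    ultimately show ?thesis by simp
  qed
  moreover have "\<sigma> (sum F {..<m}) = (\<Sum>j<m. \<sigma> (F j))"
    by (rule sum_additive_on[where A = "sa_carrier G"])
      (auto simp: F aut_add carrier_zero carrier_add)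
  ultimately have "\<sigma> (sum F {..<m}) = (w powi r) *\<^sub>G sum F {..<m}"
    by (simp add: \<sigma>F flip: scale_sum_right)
  then have "sum F {..<m} \<in> eigen r"
    by (simp add: eigen_component_def F carrier_sum)
  then show ?thesis
    unfolding eigen_proj_def F_def by (rule subspace_scale[OF subspace_eigen])
qed

text \<open>Each power of \<sigma> acts by a scalar on x, so the average collapses to the character
  sum of index i - r.\<close>

lemma eigen_proj_of_eigen:
  assumes x: "x \<in> eigen i"
  shows "eigen_proj r x = (if int m dvd i - r then x else 0)"
proof -
  have "eigen_proj r x = (1 / of_nat m) *\<^sub>G ((\<Sum>j<m. (w powi (i - r)) ^ j) *\<^sub>G x)"
    unfolding eigen_proj_def
    by (simp add: funpow_eigen[OF x] power_int_diff w_nonzero power_int_minus power_divide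
        divide_inverse power_inverse power_mult_distrib mult.commute scale_sum_left)
  then show ?thesis using m_pos by (simp add: sum_w_powi)
qed

text \<open>After exchanging the sums, the sum over r of w^(-rj) vanishes unless j = 0, and that
  term contributes m times x.\<close>

lemma sum_proj:
  assumes x: "x \<in> sa_carrier G"
  shows "(\<Sum>r<m. eigen_proj (int r) x) = x"
proof -
  have power_swap: "(w powi (- int r)) ^ j = (w powi (- int j)) ^ r" for r j
    by (simp add: power_int_minus power_inverse mult.commute flip: power_mult)
  have dvd: "m dvd j \<longleftrightarrow> j = 0" if "j < m" for j
    using that by (auto dest: dvd_imp_le)
  have "(\<Sum>r<m. eigen_proj (int r) x) =
      (1 / of_nat m) *\<^sub>G (\<Sum>r<m. \<Sum>j<m. (w powi (- int r)) ^ j *\<^sub>G (\<sigma> ^^ j) x)"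
    unfolding eigen_proj_def by (simp add: scale_sum_right)
  also have "(\<Sum>r<m. \<Sum>j<m. (w powi (- int r)) ^ j *\<^sub>G (\<sigma> ^^ j) x) =
      (\<Sum>j<m. \<Sum>r<m. (w powi (- int r)) ^ j *\<^sub>G (\<sigma> ^^ j) x)"
    by (rule sum.swap)
  also have "\<dots> = (\<Sum>j<m. (\<Sum>r<m. (w powi (- int j)) ^ r) *\<^sub>G (\<sigma> ^^ j) x)"
    unfolding scale_sum_left
    by (intro sum.cong refl arg_cong2[where f = "sa_scale G"] power_swap)
  also have "\<dots> = (\<Sum>j<m. if j = 0 then of_nat m *\<^sub>G x else 0)"
    by (rule sum.cong) (simp_all add: sum_w_powi dvd)
  also have "\<dots> = of_nat m *\<^sub>G x" using m_pos by simp
  finally show ?thesis using m_pos by simp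
qed

section \<open>The loop algebra and multiplication by z^m\<close>

lemma loop_carrier_iff: "f \<in> sa_carrier loop \<longleftrightarrow> (\<forall>i. Poly_Mapping.lookup f i \<in> eigen i)"
  by (simp add: loop_algebra_def)

lemma loop_grade_iff: "f \<in> sa_grade loop a \<longleftrightarrow>
    (\<forall>i. Poly_Mapping.lookup f i \<in> eigen i \<and> Poly_Mapping.lookup f i \<in> sa_grade G a)"
  by (simp add: loop_algebra_def)

lemma loop_grade_carrier: "f \<in> sa_grade loop a \<Longrightarrow> f \<in> sa_carrier loop"
  by (simp add: loop_carrier_iff loop_grade_iff)

lemma lookup_loop_scale [simp]:
  "Poly_Mapping.lookup (sa_scale loop c f) i = c *\<^sub>G Poly_Mapping.lookup f i"
  by (simp add: loop_algebra_def Poly_Mapping.map.rep_eq when_def)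

lemma loop_zero: "0 \<in> sa_carrier loop"
  by (simp add: loop_carrier_iff subspace_0 subspace_eigen)

lemma loop_add: "\<lbrakk>f \<in> sa_carrier loop; g \<in> sa_carrier loop\<rbrakk> \<Longrightarrow> f + g \<in> sa_carrier loop"
  by (simp add: loop_carrier_iff lookup_add subspace_add subspace_eigen)

lemma loop_diff: "\<lbrakk>f \<in> sa_carrier loop; g \<in> sa_carrier loop\<rbrakk> \<Longrightarrow> f - g \<in> sa_carrier loop"
  by (simp add: loop_carrier_iff lookup_minus subspace_diff subspace_eigen)

lemma loop_sum: "(\<And>i. i \<in> I \<Longrightarrow> f i \<in> sa_carrier loop) \<Longrightarrow> sum f I \<in> sa_carrier loop"
  by (induction I rule: infinite_finite_induct) (auto simp: loop_zero loop_add)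

lemma loop_scale: "f \<in> sa_carrier loop \<Longrightarrow> sa_scale loop c f \<in> sa_carrier loop"
  by (simp add: loop_carrier_iff subspace_scale subspace_eigen)

lemma loop_single: "x \<in> eigen i \<Longrightarrow> Poly_Mapping.single i x \<in> sa_carrier loop"
  by (auto simp: loop_carrier_iff lookup_single when_def subspace_0 subspace_eigen)

lemma loop_scale_single:
  "sa_scale loop c (Poly_Mapping.single i x) = Poly_Mapping.single i (c *\<^sub>G x)"
  by (rule poly_mapping_eqI) (simp add: lookup_single when_def)

lemma sum_single: "(\<Sum>i\<in>Poly_Mapping.keys f. Poly_Mapping.single i (Poly_Mapping.lookup f i)) = f"
  by (rule poly_mapping_eqI) (auto simp: lookup_sum lookup_single when_def in_keys_iff)

lemma loop_bracket_eq:
  "sa_bracket loop f g = (\<Sum>i\<in>Poly_Mapping.keys f. \<Sum>j\<in>Poly_Mapping.keys g.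
    Poly_Mapping.single (i + j) (sa_bracket G (Poly_Mapping.lookup f i) (Poly_Mapping.lookup g j)))"
  by (simp add: loop_algebra_def)

lemma loop_bracket_carrier:
  assumes "f \<in> sa_carrier loop" "g \<in> sa_carrier loop"
  shows "sa_bracket loop f g \<in> sa_carrier loop"
  unfolding loop_bracket_eq using assms
  by (intro loop_sum loop_single bracket_eigen) (auto simp: loop_carrier_iff)

text \<open>Multiplication by \<open>z ^ m\<close>, an element of the centroid of the loop algebra.\<close>

definition shift :: "(int \<Rightarrow>\<^sub>0 'a) \<Rightarrow> (int \<Rightarrow>\<^sub>0 'a)" where
  "shift = Poly_Mapping.map_key (\<lambda>i. i - int m)"

lemma lookup_shift [simp]: "Poly_Mapping.lookup (shift f) i = Poly_Mapping.lookup f (i - int m)"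
  by (simp add: shift_def map_key.rep_eq inj_def)

lemma keys_shift: "Poly_Mapping.keys (shift f) = (\<lambda>i. i + int m) ` Poly_Mapping.keys f"
proof (rule set_eqI)
  show "i \<in> Poly_Mapping.keys (shift f) \<longleftrightarrow> i \<in> (\<lambda>i. i + int m) ` Poly_Mapping.keys f" for i
    by (auto simp: in_keys_iff intro!: image_eqI[of i _ "i - int m"])
qed

lemma shift_add: "shift (f + g) = shift f + shift g"
  by (rule poly_mapping_eqI) (simp add: lookup_add)

lemma shift_diff: "shift (f - g) = shift f - shift g"
  by (rule poly_mapping_eqI) (simp add: lookup_minus)

lemma shift_scale: "shift (sa_scale loop c f) = sa_scale loop c (shift f)"
  by (rule poly_mapping_eqI) simp

lemma shift_single: "shift (Poly_Mapping.single i x) = Poly_Mapping.single (i + int m) x"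
  by (rule poly_mapping_eqI) (auto simp: lookup_single when_def)

lemma shift_sum: "shift (sum f I) = (\<Sum>i\<in>I. shift (f i))"
  by (rule poly_mapping_eqI) (simp add: lookup_sum)

lemma eigen_diff_period: "eigen (i - int m) = eigen i"
  using eigen_period[of i "-1"] by simp

lemma shift_carrier: "f \<in> sa_carrier loop \<Longrightarrow> shift f \<in> sa_carrier loop"
  using eigen_diff_period by (auto simp: loop_carrier_iff)

lemma shift_grade: "f \<in> sa_grade loop a \<Longrightarrow> shift f \<in> sa_grade loop a"
  using eigen_diff_period by (auto simp: loop_grade_iff)

text \<open>Multiplication by z^(-m) is the inverse; it stays inside the loop algebra because the
  eigenspaces are periodic mod \<open>m\<close>.\<close>

lemma shift_surj:
  assumes "f \<in> sa_carrier loop"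
  obtains g where "g \<in> sa_carrier loop" "shift g = f"
proof
  let ?g = "Poly_Mapping.map_key (\<lambda>i. i + int m) f"
  have lookup: "Poly_Mapping.lookup ?g i = Poly_Mapping.lookup f (i + int m)" for i
    by (simp add: map_key.rep_eq inj_def)
  show "?g \<in> sa_carrier loop"
    using assms eigen_period[of _ 1] by (auto simp: loop_carrier_iff lookup)
  show "shift ?g = f" by (rule poly_mapping_eqI) (simp add: lookup)
qed

lemma shift_bracket_left: "sa_bracket loop (shift f) g = shift (sa_bracket loop f g)"
  unfolding loop_bracket_eq keys_shift shift_sum shift_single
  by (simp add: sum.reindex inj_on_def ac_simps)

lemma shift_bracket_right: "sa_bracket loop f (shift g) = shift (sa_bracket loop f g)"
  unfolding loop_bracket_eq keys_shift shift_sum shift_single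
  by (simp add: sum.reindex inj_on_def ac_simps)

section \<open>Evaluation at z = a and a linear section of it\<close>

definition eval_at :: "'k \<Rightarrow> (int \<Rightarrow>\<^sub>0 'a) \<Rightarrow> 'a" where
  "eval_at a f = (\<Sum>i\<in>Poly_Mapping.keys f. (a powi i) *\<^sub>G Poly_Mapping.lookup f i)"

text \<open>Supports can shrink by cancellation; a common finite superset lets evaluations be
  compared term by term.\<close>

lemma eval_at_superset:
  assumes "finite A" "Poly_Mapping.keys f \<subseteq> A"
  shows "eval_at a f = (\<Sum>i\<in>A. (a powi i) *\<^sub>G Poly_Mapping.lookup f i)"
  unfolding eval_at_def
  by (rule sum.mono_neutral_left) (use assms in \<open>auto simp: in_keys_iff\<close>)

lemma eval_at_add: "eval_at a (f + g) = eval_at a f + eval_at a g"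
proof -
  let ?A = "Poly_Mapping.keys f \<union> Poly_Mapping.keys g"
  have "Poly_Mapping.keys (f + g) \<subseteq> ?A" by (rule keys_add)
  then show ?thesis
    by (simp add: eval_at_superset[of ?A] lookup_add scale_right_distrib sum.distrib)
qed

lemma eval_at_sum: "eval_at a (sum f I) = (\<Sum>i\<in>I. eval_at a (f i))"
  by (rule sum_additive_on[where A = UNIV]) (auto simp: eval_at_add)

lemma eval_at_single: "eval_at a (Poly_Mapping.single i x) = (a powi i) *\<^sub>G x"
  by (subst eval_at_superset[of "{i}"]) auto

lemma eval_at_scale: "eval_at a (sa_scale loop c f) = c *\<^sub>G eval_at a f"
proof -
  have "Poly_Mapping.keys (sa_scale loop c f) \<subseteq> Poly_Mapping.keys f"
    by (auto simp: in_keys_iff)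
  then show ?thesis
    by (simp add: eval_at_superset[of "Poly_Mapping.keys f"] scale_sum_right mult.commute)
qed

lemma eval_at_grade: "f \<in> sa_grade loop b \<Longrightarrow> eval_at a f \<in> sa_grade G b"
  unfolding eval_at_def
  by (intro subspace_sum[OF subspace_grade] subspace_scale[OF subspace_grade])
    (simp add: loop_grade_iff)

lemma eval_at_carrier: "f \<in> sa_carrier loop \<Longrightarrow> eval_at a f \<in> sa_carrier G"
  unfolding eval_at_def
  by (intro carrier_sum carrier_scale) (auto simp: loop_carrier_iff intro: eigenD)

lemma eval_at_bracket:
  assumes a: "a \<noteq> 0" and fg: "f \<in> sa_carrier loop" "g \<in> sa_carrier loop"
  shows "eval_at a (sa_bracket loop f g) = sa_bracket G (eval_at a f) (eval_at a g)"
proof -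
  have fg': "Poly_Mapping.lookup f i \<in> sa_carrier G" "Poly_Mapping.lookup g i \<in> sa_carrier G" for i
    using fg eigenD(1) by (auto simp: loop_carrier_iff)
  have "sa_bracket G (eval_at a f) (eval_at a g) =
      (\<Sum>i\<in>Poly_Mapping.keys f. \<Sum>j\<in>Poly_Mapping.keys g.
        sa_bracket G ((a powi i) *\<^sub>G Poly_Mapping.lookup f i) ((a powi j) *\<^sub>G Poly_Mapping.lookup g j))"
    unfolding eval_at_def
    by (simp add: bracket_sum_left carrier_scale carrier_sum fg')
      (simp add: bracket_sum_right carrier_scale fg')
  also have "\<dots> = eval_at a (sa_bracket loop f g)"
    unfolding loop_bracket_eq eval_at_sum eval_at_single
    by (simp add: bracket_scale_left bracket_scale_right carrier_scale fg' a power_int_add mult.commute)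
  finally show ?thesis by simp
qed

text \<open>A linear section of \<open>eval_at a\<close>: the eigencomponents go into the degrees 0
  to m - 1, scaled to cancel the powers of \<open>a\<close> that evaluation introduces. In general
  it does not preserve brackets, since degrees add up beyond m - 1.\<close>

definition lift :: "'k \<Rightarrow> 'a \<Rightarrow> (int \<Rightarrow>\<^sub>0 'a)" where
  "lift a x = (\<Sum>r<m. Poly_Mapping.single (int r) ((a powi (- int r)) *\<^sub>G eigen_proj (int r) x))"

lemma lift_carrier: "x \<in> sa_carrier G \<Longrightarrow> lift a x \<in> sa_carrier loop"
  unfolding lift_def by (intro loop_sum loop_single subspace_scale[OF subspace_eigen] eigen_proj_eigen)

lemma lift_grade:
  assumes "x \<in> sa_grade G b"
  shows "lift a x \<in> sa_grade loop b"
proof -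
  have "Poly_Mapping.lookup (lift a x) i \<in> sa_grade G b" for i
    unfolding lift_def lookup_sum lookup_single when_def using assms
    by (auto intro!: subspace_sum[OF subspace_grade] subspace_scale[OF subspace_grade]
        subspace_0[OF subspace_grade] eigen_proj_grade)
  then show ?thesis
    using lift_carrier[OF grade_carrier[OF assms]] by (simp add: loop_grade_iff loop_carrier_iff)
qed

lemma lift_add:
  "\<lbrakk>x \<in> sa_carrier G; y \<in> sa_carrier G\<rbrakk> \<Longrightarrow> lift a (x + y) = lift a x + lift a y"
  unfolding lift_def by (simp add: eigen_proj_add scale_right_distrib single_add sum.distrib)

lemma lift_scale: "x \<in> sa_carrier G \<Longrightarrow> lift a (c *\<^sub>G x) = sa_scale loop c (lift a x)"
  by (rule poly_mapping_eqI)
    (auto simp: lift_def eigen_proj_scale lookup_sum lookup_single when_def scale_sum_right mult.commute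
      intro!: sum.cong)

lemma eval_at_lift: "\<lbrakk>a \<noteq> 0; x \<in> sa_carrier G\<rbrakk> \<Longrightarrow> eval_at a (lift a x) = x"
  unfolding lift_def eval_at_sum eval_at_single
  by (simp add: power_int_minus sum_proj)

text \<open>Only the projection whose index is congruent to i mod \<open>m\<close> survives. The
  round trip thus moves a monomial to the residue of its degree, at the price of a power of
  a^m.\<close>

lemma lift_eval_at_single:
  assumes x: "x \<in> eigen i" and a: "a \<noteq> 0"
  shows "lift a (eval_at a (Poly_Mapping.single i x)) =
    Poly_Mapping.single (i mod int m) ((a powi (i - i mod int m)) *\<^sub>G x)"
proof -
  define k where "k = nat (i mod int m)"
  have k: "int k = i mod int m" "k < m" using m_pos by (auto simp: k_def nat_less_iff)
  have dvd: "int m dvd i - int r \<longleftrightarrow> r = k" if "r < m" for r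
    using that k
    by (metis mod_eq_dvd_iff mod_pos_pos_trivial of_nat_0_le_iff of_nat_eq_iff of_nat_less_iff)
  have "lift a (eval_at a (Poly_Mapping.single i x)) = (\<Sum>r<m. if r = k then
      Poly_Mapping.single (int r) ((a powi (- int r)) *\<^sub>G (a powi i) *\<^sub>G x) else 0)"
    unfolding lift_def eval_at_single
    by (rule sum.cong) (auto simp: eigen_proj_of_eigen[OF subspace_scale[OF subspace_eigen x]] dvd)
  also have "\<dots> = Poly_Mapping.single (int k) ((a powi (- int k)) *\<^sub>G (a powi i) *\<^sub>G x)"
    using k by simp
  also have "\<dots> = Poly_Mapping.single (int k) ((a powi (i - int k)) *\<^sub>G x)"
    using a by (simp add: power_int_diff power_int_minus field_simps)
  finally show ?thesis using k by simp
qed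

lemma eval_at_grade_image:
  assumes "a \<noteq> 0"
  shows "eval_at a ` sa_grade loop b = sa_grade G b"
proof (intro equalityI subsetI)
  show "x \<in> eval_at a ` sa_grade loop b" if "x \<in> sa_grade G b" for x
    by (rule image_eqI[of x "eval_at a" "lift a x"])
      (simp_all add: eval_at_lift assms grade_carrier[OF that] lift_grade[OF that])
qed (auto intro: eval_at_grade)

lemma eval_at_carrier_image:
  assumes "a \<noteq> 0"
  shows "eval_at a ` sa_carrier loop = sa_carrier G"
proof (intro equalityI subsetI)
  show "x \<in> eval_at a ` sa_carrier loop" if "x \<in> sa_carrier G" for x
    by (rule image_eqI[of x "eval_at a" "lift a x"])
      (simp_all add: eval_at_lift assms lift_carrier that)
qed (auto intro: eval_at_carrier)

end

section \<open>Finite-dimensional simple quotients of a loop algebra\<close>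

locale loop_quotient = twisted_loop G \<sigma> m w + S: simple_lie_superalgebra S
  for G :: "('k::{alg_closed_field, field_char_0}, 'a::ab_group_add) superalgebra"
    and \<sigma> :: "'a \<Rightarrow> 'a" and m :: nat and w :: 'k
    and S :: "('k, 'b::ab_group_add) superalgebra" +
  fixes \<psi> :: "(int \<Rightarrow>\<^sub>0 'a) \<Rightarrow> 'b"
  assumes finite_dimensional: "S.finite_dimensional"
    and hom_add: "\<lbrakk>f \<in> sa_carrier loop; g \<in> sa_carrier loop\<rbrakk> \<Longrightarrow> \<psi> (f + g) = \<psi> f + \<psi> g"
    and hom_scale: "f \<in> sa_carrier loop \<Longrightarrow> \<psi> (sa_scale loop c f) = sa_scale S c (\<psi> f)"
    and hom_bracket: "\<lbrakk>f \<in> sa_carrier loop; g \<in> sa_carrier loop\<rbrakk> \<Longrightarrow>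
      \<psi> (sa_bracket loop f g) = sa_bracket S (\<psi> f) (\<psi> g)"
    and hom_carrier: "\<psi> ` sa_carrier loop = sa_carrier S"
    and hom_grade: "\<psi> ` sa_grade loop b = sa_grade S b"
begin

lemma hom_closed: "f \<in> sa_carrier loop \<Longrightarrow> \<psi> f \<in> sa_carrier S"
  using hom_carrier by blast

lemma hom_diff:
  assumes "f \<in> sa_carrier loop" "g \<in> sa_carrier loop"
  shows "\<psi> (f - g) = \<psi> f - \<psi> g"
proof -
  have "\<psi> f = \<psi> (f - g) + \<psi> g" using hom_add[of "f - g" g] by (simp add: loop_diff assms)
  then show ?thesis by (metis add_diff_cancel_right')
qed

text \<open>Since \<open>[y, shift f] = [shift y, f]\<close>, the image of \<open>shift f\<close> annihilates \<open>S\<close> once \<open>\<psi> f = 0\<close>.\<close>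

lemma hom_shift_zero:
  assumes f: "f \<in> sa_carrier loop" "\<psi> f = 0"
  shows "\<psi> (shift f) = 0"
proof (rule S.annihilator_trivial)
  show "\<psi> (shift f) \<in> sa_carrier S" by (intro hom_closed shift_carrier f)
  fix y assume "y \<in> sa_carrier S"
  then obtain g where g: "g \<in> sa_carrier loop" "y = \<psi> g" using hom_carrier by blast
  have "sa_bracket S y (\<psi> (shift f)) = \<psi> (sa_bracket loop g (shift f))"
    unfolding g(2) using g f by (simp add: hom_bracket shift_carrier)
  also have "\<dots> = \<psi> (sa_bracket loop (shift g) f)"
    by (simp add: shift_bracket_left shift_bracket_right)
  also have "\<dots> = sa_bracket S (\<psi> (shift g)) 0"
    using g f by (simp add: hom_bracket shift_carrier)
  finally show "sa_bracket S y (\<psi> (shift f)) = 0"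
    using g by (simp add: hom_closed shift_carrier)
qed

text \<open>\<open>shift\<close> preserves the kernel of \<psi> and so induces an operator on
  \<open>S\<close> to which \<open>schur\<close> applies. As \<open>shift\<close> is onto, c = 0
  would force \<psi> to vanish, although its image \<open>S\<close> is nonzero.\<close>

lemma hom_shift_scalar: "\<exists>c. c \<noteq> 0 \<and> (\<forall>f\<in>sa_carrier loop. \<psi> (shift f) = sa_scale S c (\<psi> f))"
proof -
  \<comment> \<open>\<open>inv_into\<close> picks some preimage. The choice is immaterial, because
    two preimages differ by an element of the kernel, and \<open>hom_shift_zero\<close> applies to
    it.\<close>
  define T where "T y = \<psi> (shift (inv_into (sa_carrier loop) \<psi> y))" for y
  have T: "T (\<psi> f) = \<psi> (shift f)" if f: "f \<in> sa_carrier loop" for f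
  proof -
    let ?g = "inv_into (sa_carrier loop) \<psi> (\<psi> f)"
    have g: "?g \<in> sa_carrier loop" "\<psi> ?g = \<psi> f"
      using f by (auto intro: inv_into_into f_inv_into_f)
    then have "\<psi> (shift (?g - f)) = 0"
      using f by (intro hom_shift_zero loop_diff) (simp_all add: hom_diff)
    then show ?thesis
      unfolding T_def using g f by (simp add: shift_diff hom_diff shift_carrier)
  qed
  have "\<exists>c. \<forall>y\<in>sa_carrier S. T y = sa_scale S c y"
  proof (rule schur)
    show "simple_lie_superalgebra S" by (rule S.simple_lie_superalgebra_axioms)
    show "S.finite_dimensional" by (rule finite_dimensional)
    fix x y c
    show "T x \<in> sa_grade S a" if "x \<in> sa_grade S a" for a
    proof -
      obtain f where f: "f \<in> sa_grade loop a" "x = \<psi> f" using \<open>x \<in> sa_grade S a\<close> hom_grade by blast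
      then have "\<psi> (shift f) \<in> sa_grade S a" using hom_grade shift_grade by blast
      then show ?thesis using f T loop_grade_carrier by simp
    qed
    assume "x \<in> sa_carrier S"
    then obtain f where f: "f \<in> sa_carrier loop" "x = \<psi> f" using hom_carrier by blast
    then show "T (sa_scale S c x) = sa_scale S c (T x)"
      by (simp add: T loop_scale shift_scale shift_carrier flip: hom_scale)
    assume "y \<in> sa_carrier S"
    then obtain g where g: "g \<in> sa_carrier loop" "y = \<psi> g" using hom_carrier by blast
    show "T (x + y) = T x + T y"
      using f g by (simp add: T loop_add shift_add shift_carrier flip: hom_add)
    show "T (sa_bracket S x y) = sa_bracket S x (T y)"
      using f g by (simp add: T loop_bracket_carrier shift_bracket_right shift_carrier flip: hom_bracket)
  qed
  then obtain c where "\<forall>y\<in>sa_carrier S. T y = sa_scale S c y" ..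
  then have c: "\<psi> (shift f) = sa_scale S c (\<psi> f)" if "f \<in> sa_carrier loop" for f
    using that T hom_closed by metis
  have "c \<noteq> 0"
  proof
    assume "c = 0"
    then have "\<psi> f = 0" if "f \<in> sa_carrier loop" for f
      using that c shift_surj[OF that] by (metis S.scale_zero_left)
    then have "y = 0" if "y \<in> sa_carrier S" for y
      using that by (auto simp flip: hom_carrier)
    then show False using S.nonabelian S.bracket_carrier by blast
  qed
  then show ?thesis using c by blast
qed

text \<open>This says that \<psi> factors through \<open>eval_at a\<close>. On a monomial,
  \<open>lift a\<close> after \<open>eval_at a\<close> changes the degree by a multiple of
  \<open>m\<close>. The compensating power of a^m = c is exactly what \<psi> assigns to that change
  of degree.\<close>

lemma eval_point_exists: "\<exists>a. a \<noteq> 0 \<and> (\<forall>f\<in>sa_carrier loop. \<psi> (lift a (eval_at a f)) = \<psi> f)"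
proof -
  obtain c where c: "c \<noteq> 0" "\<And>f. f \<in> sa_carrier loop \<Longrightarrow> \<psi> (shift f) = sa_scale S c (\<psi> f)"
    using hom_shift_scalar by blast
  obtain a where a: "a ^ m = c" using nth_root_exists m_pos by blast
  then have a0: "a \<noteq> 0" using c m_pos by auto
  have single: "\<psi> (lift a (eval_at a (Poly_Mapping.single i x))) = \<psi> (Poly_Mapping.single i x)"
    if x: "x \<in> eigen i" for i x
  proof -
    \<comment> \<open>A normalised value of \<psi> along the degrees congruent to \<open>i\<close>.
      Raising \<open>q\<close> by one multiplies the \<psi>-value by \<open>c\<close> and the factor
      by a^(-m), so \<open>\<chi>\<close> is constant, in both directions of the integers.\<close>
    define \<chi> where "\<chi> q = sa_scale S (a powi (- (i + int m * q)))
        (\<psi> (Poly_Mapping.single (i + int m * q) x))" for q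
    have \<chi>_Suc: "\<chi> (q + 1) = \<chi> q" for q
    proof -
      have eq: "i + int m * (q + 1) = (i + int m * q) + int m" by (simp add: algebra_simps)
      have "Poly_Mapping.single (i + int m * q) x \<in> sa_carrier loop"
        using x by (intro loop_single) (simp add: eigen_period)
      then have "\<chi> (q + 1) = sa_scale S (a powi (- (i + int m * q) - int m) * c)
          (\<psi> (Poly_Mapping.single (i + int m * q) x))"
        unfolding \<chi>_def eq shift_single[symmetric] by (simp add: c(2))
      also have "a powi (- (i + int m * q) - int m) * c = a powi (- (i + int m * q))"
        using a0 a c(1) by (simp add: power_int_diff)
      finally show ?thesis unfolding \<chi>_def .
    qed
    have "\<chi> q = \<chi> 0" for q
    proof (induction q rule: int_induct[where k = 0])
      case (step2 q)
      then show ?case using \<chi>_Suc[of "q - 1"] by simp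
    qed (simp_all add: \<chi>_Suc)
    \<comment> \<open>This value of \<open>q\<close> leads from degree \<open>i\<close> to its
      residue, the degree where \<open>lift\<close> puts the component.\<close>
    then have "\<chi> (- (i div int m)) = \<chi> 0" .
    moreover have "i + int m * (- (i div int m)) = i mod int m"
      by (simp add: minus_mult_div_eq_mod)
    ultimately have \<chi>: "sa_scale S (a powi (- (i mod int m))) (\<psi> (Poly_Mapping.single (i mod int m) x)) =
        sa_scale S (a powi (- i)) (\<psi> (Poly_Mapping.single i x))"
      unfolding \<chi>_def by (simp only: mult_zero_right add_0_right)
    have x': "x \<in> eigen (i mod int m)"
      using x eigen_period[of "i mod int m" "i div int m"] by simp
    have "\<psi> (lift a (eval_at a (Poly_Mapping.single i x))) =
        sa_scale S (a powi (i - i mod int m)) (\<psi> (Poly_Mapping.single (i mod int m) x))"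
      unfolding lift_eval_at_single[OF x a0]
      by (simp add: hom_scale loop_single x' flip: loop_scale_single)
    also have "\<dots> = sa_scale S (a powi i)
        (sa_scale S (a powi (- (i mod int m))) (\<psi> (Poly_Mapping.single (i mod int m) x)))"
      using a0 by (simp add: power_int_diff power_int_minus divide_inverse)
    also have "\<dots> = \<psi> (Poly_Mapping.single i x)"
      unfolding \<chi> using a0 by (simp add: power_int_minus)
    finally show ?thesis .
  qed
  have "\<psi> (lift a (eval_at a f)) = \<psi> f" if f: "f \<in> sa_carrier loop" for f
  proof -
    let ?t = "\<lambda>i. Poly_Mapping.single i (Poly_Mapping.lookup f i)"
    have t: "?t i \<in> sa_carrier loop" "Poly_Mapping.lookup f i \<in> eigen i" for i
      using f by (auto simp: loop_carrier_iff[of f] intro: loop_single)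
    have "\<psi> (lift a (eval_at a (sum ?t (Poly_Mapping.keys f)))) =
        (\<Sum>i\<in>Poly_Mapping.keys f. \<psi> (lift a (eval_at a (?t i))))"
      by (rule sum_additive_on[where A = "sa_carrier loop" and f = "\<lambda>f. \<psi> (lift a (eval_at a f))"])
        (auto simp: eval_at_add lift_add eval_at_carrier hom_add lift_carrier t loop_zero loop_add)
    also have "\<dots> = (\<Sum>i\<in>Poly_Mapping.keys f. \<psi> (?t i))"
      by (simp add: single t)
    also have "\<dots> = \<psi> (sum ?t (Poly_Mapping.keys f))"
      by (rule sum_additive_on[symmetric, where A = "sa_carrier loop"])
        (auto simp: hom_add t loop_zero loop_add)
    finally show ?thesis by (simp add: sum_single)
  qed
  then show ?thesis using a0 by blast
qed

text \<open>With \<open>a\<close> as above, \<psi> is \<open>h\<close> after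
  \<open>eval_at a\<close>, where \<open>h\<close> is \<psi> after \<open>lift a\<close>.
  Surjectivity and compatibility with the grading pass from \<psi> and \<open>eval_at a\<close> to
  \<open>h\<close>. The kernel of \<open>h\<close> is a graded ideal of the simple \<open>G\<close>,
  and it is proper because \<open>S\<close> is nonzero.\<close>

lemma isomorphic:
  assumes G: "simple_lie_superalgebra G"
  shows "G \<simeq>\<^sub>s S"
proof -
  obtain a where a: "a \<noteq> 0" "\<And>f. f \<in> sa_carrier loop \<Longrightarrow> \<psi> (lift a (eval_at a f)) = \<psi> f"
    using eval_point_exists by blast
  define h where "h x = \<psi> (lift a x)" for x
  have h_eval: "h (eval_at a f) = \<psi> f" if "f \<in> sa_carrier loop" for f
    unfolding h_def using a that by blast
  have h_add: "h (x + y) = h x + h y" if "x \<in> sa_carrier G" "y \<in> sa_carrier G" for x y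
    unfolding h_def using that by (simp add: lift_add hom_add lift_carrier)
  have h_scale: "h (c *\<^sub>G x) = sa_scale S c (h x)" if "x \<in> sa_carrier G" for c x
    unfolding h_def using that by (simp add: lift_scale hom_scale lift_carrier)
  have h_image_eval: "h ` eval_at a ` A = \<psi> ` A" if "A \<subseteq> sa_carrier loop" for A
    unfolding image_image by (rule image_cong) (use h_eval that in auto)
  have h_carrier: "h ` sa_carrier G = sa_carrier S"
    using h_image_eval[OF order_refl] by (simp only: eval_at_carrier_image[OF a(1)] hom_carrier)
  have h_grade: "h ` sa_grade G b = sa_grade S b" for b
    using h_image_eval[of "sa_grade loop b"] loop_grade_carrier subsetI
    by (metis eval_at_grade_image[OF a(1)] hom_grade)
  have h_bracket: "h (sa_bracket G x y) = sa_bracket S (h x) (h y)"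
    if xy: "x \<in> sa_carrier G" "y \<in> sa_carrier G" for x y
  proof -
    \<comment> \<open>\<open>lift a\<close> may fail to preserve brackets, so the bracket is written
      as an evaluation, where \<open>h\<close> can be replaced by \<psi>.\<close>
    have bracket: "sa_bracket G x y = eval_at a (sa_bracket loop (lift a x) (lift a y))"
      using xy a(1) by (simp add: eval_at_bracket lift_carrier eval_at_lift)
    show ?thesis
      unfolding bracket using xy
      by (subst h_eval) (simp_all add: loop_bracket_carrier lift_carrier hom_bracket h_def)
  qed
  let ?I = "{x \<in> sa_carrier G. h x = 0}"
  have h0: "h 0 = 0" using h_scale[of 0 0] carrier_zero by simp
  have "graded_ideal ?I"
  proof (rule graded_idealI)
    show "subspace ?I"
      unfolding subspace_def by (auto simp: carrier_zero carrier_add carrier_scale h0 h_add h_scale)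
    fix x y assume xy: "x \<in> sa_grade G 0" "y \<in> sa_grade G 1" "x + y \<in> ?I"
    have "h x \<in> sa_grade S 0" "h y \<in> sa_grade S 1" using xy(1,2) h_grade by blast+
    moreover have "h x + h y = 0 + 0" using xy h_add grade_carrier by auto
    ultimately have "h x = 0"
      using S.grade_unique(1)[of "h x" 0 "h y" 0] S.subspace_0[OF S.subspace_grade] by blast
    then show "x \<in> ?I" using xy grade_carrier by blast
  next
    have "h x \<in> sa_carrier S" if "x \<in> sa_carrier G" for x using that h_carrier by blast
    then show "sa_bracket G x y \<in> ?I" if "x \<in> sa_carrier G" "y \<in> ?I" for x y
      using that by (auto simp: h_bracket bracket_carrier)
  qed auto
  moreover have "?I \<noteq> sa_carrier G"
  proof
    assume "?I = sa_carrier G"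
    then have "h x = 0" if "x \<in> sa_carrier G" for x
      using that by blast
    then have "y = 0" if "y \<in> sa_carrier S" for y
      using that by (auto simp flip: h_carrier)
    then show False using S.nonabelian S.bracket_carrier by blast
  qed
  ultimately have kernel: "?I = {0}"
    using simple_lie_superalgebra.ideal_trivial[OF G] by blast
  have "inj_on h (sa_carrier G)"
  proof (rule inj_onI)
    fix x y assume xy: "x \<in> sa_carrier G" "y \<in> sa_carrier G" "h x = h y"
    have "h x = h (x - y) + h y" using h_add[of "x - y" y] xy carrier_diff by simp
    then have "x - y \<in> ?I" using xy carrier_diff by simp
    then show "x = y" using kernel by auto
  qed
  then have "superalgebra_iso G S h"
    unfolding superalgebra_iso_def bij_betw_def
    using h_add h_scale h_bracket h_carrier h_grade by auto
  then show ?thesis unfolding superalgebra_isomorphic_def by blast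
qed

end

theorem theorem3:
  fixes G1 :: "('k :: {alg_closed_field, field_char_0}, 'a :: ab_group_add) superalgebra"
    and G2 :: "('k, 'b :: ab_group_add) superalgebra"
    and \<sigma>1 :: "'a \<Rightarrow> 'a" and \<sigma>2 :: "'b \<Rightarrow> 'b"
    and \<zeta> :: "nat \<Rightarrow> 'k" and m1 m2 :: nat
  assumes "compatible_roots \<zeta>"
    and "simple_lie_superalgebra G1" and "lie_superalgebra.finite_dimensional G1"
    and "simple_lie_superalgebra G2" and "lie_superalgebra.finite_dimensional G2"
    and "superalgebra_aut G1 \<sigma>1" and "has_period G1 \<sigma>1 m1"
    and "superalgebra_aut G2 \<sigma>2" and "has_period G2 \<sigma>2 m2"
    and "loop_algebra G1 \<sigma>1 (\<zeta> m1) \<simeq>\<^sub>s loop_algebra G2 \<sigma>2 (\<zeta> m2)"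
  shows "G1 \<simeq>\<^sub>s G2"
proof -
  interpret S1: simple_lie_superalgebra G1 by fact
  interpret S2: simple_lie_superalgebra G2 by fact
  \<comment> \<open>Periods are at least 1, so the family \<zeta> provides a primitive root for each
    of them.\<close>
  interpret L1: twisted_loop G1 \<sigma>1 m1 "\<zeta> m1"
    by unfold_locales (use assms in \<open>auto simp: compatible_roots_def has_period_def\<close>)
  interpret L2: twisted_loop G2 \<sigma>2 m2 "\<zeta> m2"
    by unfold_locales (use assms in \<open>auto simp: compatible_roots_def has_period_def\<close>)
  obtain \<phi> where \<phi>: "superalgebra_iso L1.loop L2.loop \<phi>"
    using assms(10) unfolding superalgebra_isomorphic_def by blast
  then have \<phi>_image: "\<phi> ` sa_carrier L1.loop = sa_carrier L2.loop"
      "\<phi> ` sa_grade L1.loop b = sa_grade L2.loop b" for b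
    unfolding superalgebra_iso_def bij_betw_def by auto
  note \<phi>_hom = \<phi>[unfolded superalgebra_iso_def, THEN conjunct2]
  note \<phi>_add = \<phi>_hom[THEN conjunct1, rule_format]
    and \<phi>_scale = \<phi>_hom[THEN conjunct2, THEN conjunct1, rule_format]
    and \<phi>_bracket = \<phi>_hom[THEN conjunct2, THEN conjunct2, THEN conjunct1, rule_format]
  have \<phi>_closed: "\<phi> f \<in> sa_carrier L2.loop" if "f \<in> sa_carrier L1.loop" for f
    using that \<phi>_image(1) by blast
  \<comment> \<open>The point 1 is nonzero, as \<open>eval_at_bracket\<close> and the surjectivity
    of evaluation require. Composed with \<phi>, evaluation there is a graded epimorphism onto the
    simple \<open>G2\<close>.\<close>
  interpret loop_quotient G1 \<sigma>1 m1 "\<zeta> m1" G2 "\<lambda>f. L2.eval_at 1 (\<phi> f)"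
  proof
    show "(\<lambda>f. L2.eval_at 1 (\<phi> f)) ` sa_carrier L1.loop = sa_carrier G2"
      unfolding image_image[of "L2.eval_at 1" \<phi>, symmetric] \<phi>_image
      by (rule L2.eval_at_carrier_image) simp
    show "(\<lambda>f. L2.eval_at 1 (\<phi> f)) ` sa_grade L1.loop b = sa_grade G2 b" for b
      unfolding image_image[of "L2.eval_at 1" \<phi>, symmetric] \<phi>_image
      by (rule L2.eval_at_grade_image) simp
  qed (simp_all add: assms(5) \<phi>_add \<phi>_scale \<phi>_bracket \<phi>_closed
      L2.eval_at_add L2.eval_at_scale L2.eval_at_bracket)
  show ?thesis by (rule isomorphic) fact
qed

end
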